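(* Let $(M,\varphi,\xi,\eta,g)$ be an almost contact B-metric manifold with associated metric $\tilde g$. The curvature tensors of $\nabla^\circ$ and $\nabla$ (respectively, of $\widetilde\nabla^\circ$ and $\widetilde\nabla$) are related as follows, for all $x,y,z,w$: $$R^\circ(x,y,z,w)=R(x,y,\varphi^2z,\varphi^2w)+\pi_1(S(x),S(y),z,w),$$ $$\widetilde R^\circ(x,y,z,w)=\widetilde R(x,y,\varphi^2z,\varphi^2w)+\widetilde\pi_1(\widetilde S(x),\widetilde S(y),z,w).$$
   Context: An almost contact B-metric manifold $(M,\varphi,\xi,\eta,g)$ is a $(2n+1)$-dimensional manifold with an endomorphism $\varphi$ of $TM$, a vector field $\xi$, a 1-form $\eta$ and a pseudo-Riemannian metric $g$ of signature $(n+1,n)$ with $\varphi\xi=0$, $\varphi^2=-I+\eta\otimes\xi$, $\eta\circ\varphi=0$, $\eta(\xi)=1$, $g(\varphi x,\varphi y)=-g(x,y)+\eta(x)\eta(y)$. The associated metric $\tilde g(x,y)=g(x,\varphi y)+\eta(x)\eta(y)$ is also a B-metric. $\nabla$ and $\widetilde\nabla$ are the Levi-Civita connections of $g$ and $\tilde g$. For a vector $x$ put $x^{\mathrm h}=x-\eta(x)\xi$, $x^{\mathrm v}=\eta(x)\xi$. The Schouten-van Kampen connections are $\nabla^\circ_xy=(\nabla_xy^{\mathrm h})^{\mathrm h}+(\nabla_xy^{\mathrm v})^{\mathrm v}$ and $\widetilde\nabla^\circ_xy=(\widetilde\nabla_xy^{\mathrm h})^{\mathrm h}+(\widetilde\nabla_xy^{\mathrm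 v})^{\mathrm v}$. Shape operators: $S(x)=-\nabla_x\xi$, $\widetilde S(x)=-\widetilde\nabla_x\xi$. The curvature of a connection $\nabla$ is $R(x,y)z=\nabla_x\nabla_yz-\nabla_y\nabla_xz-\nabla_{[x,y]}z$. The $(0,4)$-tensors $R,R^\circ$ of $\nabla,\nabla^\circ$ are obtained by $g$, e.g. $R(x,y,z,w)=g(R(x,y)z,w)$; the $(0,4)$-tensors $\widetilde R,\widetilde R^\circ$ of $\widetilde\nabla,\widetilde\nabla^\circ$ are obtained by $\tilde g$. Finally $\pi_1(x,y,z,w)=g(y,z)g(x,w)-g(x,z)g(y,w)$ and $\widetilde\pi_1$ is the same expression with $\tilde g$ in place of $g$. *)

theory Defs
  imports "HOL-Analysis.Analysis" "HOL-Library.Function_Algebras"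
begin

text \<open>
  A manifold is a whole type \<open>'m\<close> (Hausdorff, second countable) together with an atlas of charts
  \<open>(U, \<psi>)\<close> modelled on a Euclidean space \<open>'e\<close>.  The tangent calculus follows O'Neill,
  \<^emph>\<open>Semi-Riemannian Geometry\<close>: tangent vectors at \<open>p\<close> are derivations at \<open>p\<close> of the algebra of
  smooth functions, and tensor fields are pointwise multilinear maps which send smooth vector fields
  to smooth objects.  Sums, differences and negatives of tangent vectors, vector fields and scalar
  fields are the pointwise ones of \<open>Function_Algebras\<close>.
\<close>

subsection \<open>Smooth manifolds\<close>

primrec Ck_on :: "nat \<Rightarrow> ('a::euclidean_space \<Rightarrow> 'b::real_normed_vector) \<Rightarrow> 'a set \<Rightarrow> bool" where
  "Ck_on 0 f U = continuous_on U f"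
| "Ck_on (Suc k) f U =
     ((\<forall>x\<in>U. f differentiable (at x)) \<and>
      (\<forall>v. Ck_on k (\<lambda>x. frechet_derivative f (at x) v) U))"

text \<open>Only used for open \<open>U\<close>, where it depends on the values of \<open>f\<close> on \<open>U\<close> alone.\<close>

definition smooth_on :: "('a::euclidean_space \<Rightarrow> 'b::real_normed_vector) \<Rightarrow> 'a set \<Rightarrow> bool" where
  "smooth_on f U \<longleftrightarrow> (\<forall>k. Ck_on k f U)"

type_synonym ('m, 'e) atlas = "('m set \<times> ('m \<Rightarrow> 'e)) set"

definition smooth_atlas ::
  "('m::{t2_space,second_countable_topology}, 'e::euclidean_space) atlas \<Rightarrow> bool" where
  "smooth_atlas A \<longleftrightarrow>
     (\<Union>(U, \<psi>)\<in>A. U) = UNIV \<and>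
     (\<forall>(U, \<psi>)\<in>A. open U \<and> open (\<psi> ` U) \<and> homeomorphism U (\<psi> ` U) \<psi> (inv_into U \<psi>)) \<and>
     (\<forall>(U, \<psi>)\<in>A. \<forall>(V, \<theta>)\<in>A. smooth_on (\<theta> \<circ> inv_into U \<psi>) (\<psi> ` (U \<inter> V)))"

definition scalar_fields ::
  "('m::topological_space, 'e::euclidean_space) atlas \<Rightarrow> ('m \<Rightarrow> real) set" where
  "scalar_fields A = {f. \<forall>(U, \<psi>)\<in>A. smooth_on (f \<circ> inv_into U \<psi>) (\<psi> ` U)}"

subsection \<open>Tangent vectors and vector fields\<close>

type_synonym 'm tvec = "('m \<Rightarrow> real) \<Rightarrow> real"
type_synonym 'm vfield = "'m \<Rightarrow> 'm tvec"

definition tvec_scale :: "real \<Rightarrow> 'm tvec \<Rightarrow> 'm tvec"  (infixr "*\<^sub>T" 75) where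
  "c *\<^sub>T v = (\<lambda>f. c * v f)"

definition vfield_scale :: "('m \<Rightarrow> real) \<Rightarrow> 'm vfield \<Rightarrow> 'm vfield"  (infixr "*\<^sub>V" 75) where
  "h *\<^sub>V X = (\<lambda>p. h p *\<^sub>T X p)"

text \<open>
  HOL functions being total, a derivation is normalised to vanish on functions that are not smooth,
  so that two tangent vectors are equal iff they agree on all smooth functions.
\<close>

definition tangent_space ::
  "('m::topological_space, 'e::euclidean_space) atlas \<Rightarrow> 'm \<Rightarrow> 'm tvec set" where
  "tangent_space A p = {v.
     (\<forall>f\<in>scalar_fields A. \<forall>h\<in>scalar_fields A. v (\<lambda>q. f q + h q) = v f + v h) \<and>
     (\<forall>c. \<forall>f\<in>scalar_fields A. v (\<lambda>q. c * f q) = c * v f) \<and>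
     (\<forall>f\<in>scalar_fields A. \<forall>h\<in>scalar_fields A. v (\<lambda>q. f q * h q) = v f * h p + f p * v h) \<and>
     (\<forall>f. f \<notin> scalar_fields A \<longrightarrow> v f = 0)}"

definition vf_apply :: "'m vfield \<Rightarrow> ('m \<Rightarrow> real) \<Rightarrow> ('m \<Rightarrow> real)" where
  "vf_apply X f = (\<lambda>p. X p f)"

definition vector_fields ::
  "('m::topological_space, 'e::euclidean_space) atlas \<Rightarrow> 'm vfield set" where
  "vector_fields A = {X. (\<forall>p. X p \<in> tangent_space A p) \<and>
     (\<forall>f\<in>scalar_fields A. vf_apply X f \<in> scalar_fields A)}"

definition lie_bracket :: "'m vfield \<Rightarrow> 'm vfield \<Rightarrow> 'm vfield" where
  "lie_bracket X Y = (\<lambda>p f. X p (vf_apply Y f) - Y p (vf_apply X f))"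

subsection \<open>Tensor fields\<close>

definition vf_endo :: "('m \<Rightarrow> 'm tvec \<Rightarrow> 'm tvec) \<Rightarrow> 'm vfield \<Rightarrow> 'm vfield" where
  "vf_endo \<phi> X = (\<lambda>p. \<phi> p (X p))"

definition vf_form :: "('m \<Rightarrow> 'm tvec \<Rightarrow> real) \<Rightarrow> 'm vfield \<Rightarrow> 'm \<Rightarrow> real" where
  "vf_form \<eta> X = (\<lambda>p. \<eta> p (X p))"

definition vf_bilin ::
  "('m \<Rightarrow> 'm tvec \<Rightarrow> 'm tvec \<Rightarrow> real) \<Rightarrow> 'm vfield \<Rightarrow> 'm vfield \<Rightarrow> 'm \<Rightarrow> real" where
  "vf_bilin g X Y = (\<lambda>p. g p (X p) (Y p))"

definition endomorphism_field ::
  "('m::topological_space, 'e::euclidean_space) atlas \<Rightarrow> ('m \<Rightarrow> 'm tvec \<Rightarrow> 'm tvec) \<Rightarrow> bool" where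
  "endomorphism_field A \<phi> \<longleftrightarrow>
     (\<forall>p. \<forall>v\<in>tangent_space A p. \<phi> p v \<in> tangent_space A p) \<and>
     (\<forall>p. \<forall>v\<in>tangent_space A p. \<forall>w\<in>tangent_space A p. \<phi> p (v + w) = \<phi> p v + \<phi> p w) \<and>
     (\<forall>p c. \<forall>v\<in>tangent_space A p. \<phi> p (c *\<^sub>T v) = c *\<^sub>T \<phi> p v) \<and>
     (\<forall>X\<in>vector_fields A. vf_endo \<phi> X \<in> vector_fields A)"

definition one_form ::
  "('m::topological_space, 'e::euclidean_space) atlas \<Rightarrow> ('m \<Rightarrow> 'm tvec \<Rightarrow> real) \<Rightarrow> bool" where
  "one_form A \<eta> \<longleftrightarrow>
     (\<forall>p. \<forall>v\<in>tangent_space A p. \<forall>w\<in>tangent_space A p. \<eta> p (v + w) = \<eta> p v + \<eta> p w) \<and>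
     (\<forall>p c. \<forall>v\<in>tangent_space A p. \<eta> p (c *\<^sub>T v) = c * \<eta> p v) \<and>
     (\<forall>X\<in>vector_fields A. vf_form \<eta> X \<in> scalar_fields A)"

text \<open>
  Signature \<open>(r, s)\<close>: every tangent space has an orthonormal basis with \<open>r\<close> vectors of square \<open>+1\<close>
  followed by \<open>s\<close> vectors of square \<open>-1\<close>.  Linear independence and nondegeneracy follow from
  orthonormality, so that only spanning is demanded.
\<close>

definition pseudo_riemannian_metric ::
  "('m::topological_space, 'e::euclidean_space) atlas \<Rightarrow> nat \<Rightarrow> nat \<Rightarrow>
    ('m \<Rightarrow> 'm tvec \<Rightarrow> 'm tvec \<Rightarrow> real) \<Rightarrow> bool" where
  "pseudo_riemannian_metric A r s g \<longleftrightarrow>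
     (\<forall>p. \<forall>u\<in>tangent_space A p. \<forall>v\<in>tangent_space A p. g p u v = g p v u) \<and>
     (\<forall>p. \<forall>u\<in>tangent_space A p. \<forall>v\<in>tangent_space A p. \<forall>w\<in>tangent_space A p.
        g p (u + v) w = g p u w + g p v w) \<and>
     (\<forall>p c. \<forall>u\<in>tangent_space A p. \<forall>v\<in>tangent_space A p. g p (c *\<^sub>T u) v = c * g p u v) \<and>
     (\<forall>X\<in>vector_fields A. \<forall>Y\<in>vector_fields A. vf_bilin g X Y \<in> scalar_fields A) \<and>
     (\<forall>p. \<exists>e :: nat \<Rightarrow> 'm tvec.
        (\<forall>i<r + s. e i \<in> tangent_space A p) \<and>
        (\<forall>v\<in>tangent_space A p. \<exists>c :: nat \<Rightarrow> real. v = (\<Sum>i<r + s. c i *\<^sub>T e i)) \<and>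
        (\<forall>i<r + s. \<forall>j<r + s.
           g p (e i) (e j) = (if i \<noteq> j then 0 else if i < r then 1 else - 1)))"

subsection \<open>Connections and curvature\<close>

type_synonym 'm connection = "'m vfield \<Rightarrow> 'm vfield \<Rightarrow> 'm vfield"

definition affine_connection ::
  "('m::topological_space, 'e::euclidean_space) atlas \<Rightarrow> 'm connection \<Rightarrow> bool" where
  "affine_connection A D \<longleftrightarrow>
     (\<forall>X\<in>vector_fields A. \<forall>Y\<in>vector_fields A. D X Y \<in> vector_fields A) \<and>
     (\<forall>X\<in>vector_fields A. \<forall>X'\<in>vector_fields A. \<forall>Y\<in>vector_fields A.
        D (X + X') Y = D X Y + D X' Y) \<and>
     (\<forall>f\<in>scalar_fields A. \<forall>X\<in>vector_fields A. \<forall>Y\<in>vector_fields A.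
        D (f *\<^sub>V X) Y = f *\<^sub>V D X Y) \<and>
     (\<forall>X\<in>vector_fields A. \<forall>Y\<in>vector_fields A. \<forall>Y'\<in>vector_fields A.
        D X (Y + Y') = D X Y + D X Y') \<and>
     (\<forall>f\<in>scalar_fields A. \<forall>X\<in>vector_fields A. \<forall>Y\<in>vector_fields A.
        D X (f *\<^sub>V Y) = vf_apply X f *\<^sub>V Y + f *\<^sub>V D X Y)"

definition levi_civita_connection ::
  "('m::topological_space, 'e::euclidean_space) atlas \<Rightarrow>
    ('m \<Rightarrow> 'm tvec \<Rightarrow> 'm tvec \<Rightarrow> real) \<Rightarrow> 'm connection \<Rightarrow> bool" where
  "levi_civita_connection A g D \<longleftrightarrow>
     affine_connection A D \<and>
     (\<forall>X\<in>vector_fields A. \<forall>Y\<in>vector_fields A. D X Y - D Y X = lie_bracket X Y) \<and>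
     (\<forall>X\<in>vector_fields A. \<forall>Y\<in>vector_fields A. \<forall>Z\<in>vector_fields A. \<forall>p.
        vf_apply X (vf_bilin g Y Z) p = vf_bilin g (D X Y) Z p + vf_bilin g Y (D X Z) p)"

definition curvature ::
  "'m connection \<Rightarrow> 'm vfield \<Rightarrow> 'm vfield \<Rightarrow> 'm vfield \<Rightarrow> 'm vfield" where
  "curvature D X Y Z = D X (D Y Z) - D Y (D X Z) - D (lie_bracket X Y) Z"

definition curvature4 ::
  "('m \<Rightarrow> 'm tvec \<Rightarrow> 'm tvec \<Rightarrow> real) \<Rightarrow> 'm connection \<Rightarrow>
    'm vfield \<Rightarrow> 'm vfield \<Rightarrow> 'm vfield \<Rightarrow> 'm vfield \<Rightarrow> 'm \<Rightarrow> real" where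
  "curvature4 g D X Y Z W = vf_bilin g (curvature D X Y Z) W"

definition pi1 ::
  "('m \<Rightarrow> 'm tvec \<Rightarrow> 'm tvec \<Rightarrow> real) \<Rightarrow>
    'm vfield \<Rightarrow> 'm vfield \<Rightarrow> 'm vfield \<Rightarrow> 'm vfield \<Rightarrow> 'm \<Rightarrow> real" where
  "pi1 g X Y Z W =
     (\<lambda>p. vf_bilin g Y Z p * vf_bilin g X W p - vf_bilin g X Z p * vf_bilin g Y W p)"

subsection \<open>Almost contact B-metric manifolds\<close>

locale almost_contact_B_metric_manifold =
  fixes A :: "('m::{t2_space,second_countable_topology}, 'e::euclidean_space) atlas"
    and n :: nat
    and \<phi> :: "'m \<Rightarrow> 'm tvec \<Rightarrow> 'm tvec"
    and \<xi> :: "'m vfield"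
    and \<eta> :: "'m \<Rightarrow> 'm tvec \<Rightarrow> real"
    and g :: "'m \<Rightarrow> 'm tvec \<Rightarrow> 'm tvec \<Rightarrow> real"
  assumes atlas: "smooth_atlas A"
    and dimension: "DIM('e) = 2 * n + 1"
    and phi: "endomorphism_field A \<phi>"
    and xi: "\<xi> \<in> vector_fields A"
    and eta: "one_form A \<eta>"
    and metric: "pseudo_riemannian_metric A (n + 1) n g"
    and phi_xi: "\<And>p. \<phi> p (\<xi> p) = 0"
    and phi_phi: "\<And>p v. v \<in> tangent_space A p \<Longrightarrow> \<phi> p (\<phi> p v) = - v + \<eta> p v *\<^sub>T \<xi> p"
    and eta_phi: "\<And>p v. v \<in> tangent_space A p \<Longrightarrow> \<eta> p (\<phi> p v) = 0"
    and eta_xi: "\<And>p. \<eta> p (\<xi> p) = 1"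
    and B_metric: "\<And>p v w. v \<in> tangent_space A p \<Longrightarrow> w \<in> tangent_space A p \<Longrightarrow>
          g p (\<phi> p v) (\<phi> p w) = - g p v w + \<eta> p v * \<eta> p w"

definition associated_metric ::
  "('m \<Rightarrow> 'm tvec \<Rightarrow> 'm tvec) \<Rightarrow> ('m \<Rightarrow> 'm tvec \<Rightarrow> real) \<Rightarrow>
    ('m \<Rightarrow> 'm tvec \<Rightarrow> 'm tvec \<Rightarrow> real) \<Rightarrow> ('m \<Rightarrow> 'm tvec \<Rightarrow> 'm tvec \<Rightarrow> real)" where
  "associated_metric \<phi> \<eta> g = (\<lambda>p v w. g p v (\<phi> p w) + \<eta> p v * \<eta> p w)"

definition vertical :: "'m vfield \<Rightarrow> ('m \<Rightarrow> 'm tvec \<Rightarrow> real) \<Rightarrow> 'm vfield \<Rightarrow> 'm vfield" where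
  "vertical \<xi> \<eta> X = vf_form \<eta> X *\<^sub>V \<xi>"

definition horizontal :: "'m vfield \<Rightarrow> ('m \<Rightarrow> 'm tvec \<Rightarrow> real) \<Rightarrow> 'm vfield \<Rightarrow> 'm vfield" where
  "horizontal \<xi> \<eta> X = X - vf_form \<eta> X *\<^sub>V \<xi>"

definition schouten_van_kampen ::
  "'m vfield \<Rightarrow> ('m \<Rightarrow> 'm tvec \<Rightarrow> real) \<Rightarrow> 'm connection \<Rightarrow> 'm connection" where
  "schouten_van_kampen \<xi> \<eta> D X Y =
     horizontal \<xi> \<eta> (D X (horizontal \<xi> \<eta> Y)) + vertical \<xi> \<eta> (D X (vertical \<xi> \<eta> Y))"

definition shape_operator :: "'m vfield \<Rightarrow> 'm connection \<Rightarrow> 'm vfield \<Rightarrow> 'm vfield" where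
  "shape_operator \<xi> D X = - D X \<xi>"

end

theory Submission
  imports Defs
begin

text \<open>
  The two identities are one statement about a metric \<open>G\<close> with a unit field \<open>\<xi>\<close> whose dual form is
  \<open>\<eta>\<close>: both \<open>g\<close> and the associated metric are symmetric and satisfy \<open>G v \<xi> = \<eta> v\<close>, by the
  B-metric identity.  Write \<open>h\<close> for the horizontal projection and \<open>S X = - D X \<xi>\<close>.

  Differentiating \<open>G \<xi> \<xi> = 1\<close> shows that \<open>S X\<close> is horizontal, and differentiating \<open>G Z \<xi> = 0\<close> for a
  horizontal \<open>Z\<close> gives the Weingarten formula \<open>\<eta> (D X Z) = G Z (S X)\<close>.  The Schouten-van Kampen
  connection is thus \<open>h (D X (h Y)) + X (\<eta> Y) \<xi>\<close>: it is the projection of \<open>D\<close> on the horizontal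
  distribution, and makes \<open>\<xi>\<close> parallel.  Its curvature has no vertical part, since
  \<open>x (y f) - y (x f) - [x, y] f = 0\<close>.  In the horizontal part every inner projection removes the
  vector field \<open>\<eta> (D y Z) \<xi>\<close>, whose derivative along \<open>x\<close> has the horizontal part
  \<open>- \<eta> (D y Z) S x = - G Z (S y) S x\<close>.  Removing it, and antisymmetrising in \<open>x\<close> and \<open>y\<close>, gives
  the term \<open>\<pi>\<^sub>1\<close>, as in the classical Gauss equation.  Finally \<open>\<phi>\<^sup>2 = - h\<close>, and the two signs in
  \<open>R (x, y, \<phi>\<^sup>2 z, \<phi>\<^sup>2 w)\<close> cancel.
\<close>

section \<open>Smooth functions and vector fields\<close>

lemma Ck_on_cong:
  assumes "open U" "\<And>x. x \<in> U \<Longrightarrow> f x = h x" "Ck_on k f U"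
  shows "Ck_on k h U"
  using assms(2,3)
proof (induction k arbitrary: f h)
  case 0
  then show ?case using continuous_on_cong[of U U f h] by simp
next
  case (Suc k)
  have deriv: "(h has_derivative frechet_derivative f (at x)) (at x)" if "x \<in> U" for x
  proof (rule has_derivative_transform_within_open[OF _ assms(1) that])
    show "(f has_derivative frechet_derivative f (at x)) (at x)"
      using Suc.prems(2) that by (simp add: frechet_derivative_works)
  qed (use Suc.prems(1) in simp)
  have "Ck_on k (\<lambda>x. frechet_derivative h (at x) v) U" for v
  proof (rule Suc.IH)
    show "frechet_derivative f (at x) v = frechet_derivative h (at x) v" if "x \<in> U" for x
      using frechet_derivative_at[OF deriv[OF that]] by simp
    show "Ck_on k (\<lambda>x. frechet_derivative f (at x) v) U"
      using Suc.prems(2) by simp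
  qed
  then show ?case using deriv by (auto simp: differentiable_def)
qed

lemma Ck_on_diff:
  assumes "open U" "Ck_on k f U" "Ck_on k h U"
  shows "Ck_on k (\<lambda>x. f x - h x) U"
  using assms(2,3)
proof (induction k arbitrary: f h)
  case 0
  then show ?case by (simp add: continuous_on_diff)
next
  case (Suc k)
  let ?f' = "\<lambda>x. frechet_derivative f (at x)" and ?h' = "\<lambda>x. frechet_derivative h (at x)"
  have deriv: "((\<lambda>x. f x - h x) has_derivative (\<lambda>v. ?f' x v - ?h' x v)) (at x)" if "x \<in> U" for x
    using Suc.prems that by (intro has_derivative_diff) (simp_all add: frechet_derivative_works)
  have "Ck_on k (\<lambda>x. frechet_derivative (\<lambda>x. f x - h x) (at x) v) U" for v
  proof (rule Ck_on_cong[OF assms(1)])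
    show "?f' x v - ?h' x v = frechet_derivative (\<lambda>x. f x - h x) (at x) v" if "x \<in> U" for x
      using frechet_derivative_at[OF deriv[OF that]] by metis
    show "Ck_on k (\<lambda>x. ?f' x v - ?h' x v) U"
      using Suc.prems by (intro Suc.IH) simp_all
  qed
  then show ?case using deriv by (auto simp: differentiable_def)
qed

lemma scalar_fields_diff:
  assumes "smooth_atlas A" "f \<in> scalar_fields A" "h \<in> scalar_fields A"
  shows "(\<lambda>q. f q - h q) \<in> scalar_fields A"
  using assms unfolding scalar_fields_def smooth_atlas_def smooth_on_def
  by (fastforce simp: comp_def intro!: Ck_on_diff)

lemma tangent_space_zero: "0 \<in> tangent_space A p"
  by (simp add: tangent_space_def)

lemma tangent_space_add:
  "v \<in> tangent_space A p \<Longrightarrow> w \<in> tangent_space A p \<Longrightarrow> v + w \<in> tangent_space A p"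
  by (simp add: tangent_space_def algebra_simps)

lemma tangent_space_scale: "v \<in> tangent_space A p \<Longrightarrow> c *\<^sub>T v \<in> tangent_space A p"
  by (simp add: tangent_space_def tvec_scale_def algebra_simps)

lemma tangent_space_minus: "v \<in> tangent_space A p \<Longrightarrow> - v \<in> tangent_space A p"
  by (simp add: tangent_space_def algebra_simps)

lemma tangent_space_diff:
  "v \<in> tangent_space A p \<Longrightarrow> w \<in> tangent_space A p \<Longrightarrow> v - w \<in> tangent_space A p"
  by (simp add: tangent_space_def algebra_simps)

lemmas tangent_space_intros =
  tangent_space_zero tangent_space_add tangent_space_scale tangent_space_minus tangent_space_diff

lemma vector_field_at: "X \<in> vector_fields A \<Longrightarrow> X p \<in> tangent_space A p"
  by (simp add: vector_fields_def)

lemma vector_fields_diff: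
  assumes "smooth_atlas A" "X \<in> vector_fields A" "Y \<in> vector_fields A"
  shows "X - Y \<in> vector_fields A"
  using assms
  by (auto simp: vector_fields_def vf_apply_def tangent_space_diff intro!: scalar_fields_diff)

lemma vector_fields_minus:
  assumes "smooth_atlas A" "X \<in> vector_fields A"
  shows "- X \<in> vector_fields A"
  using vector_fields_diff[OF assms(1) vector_fields_diff[OF assms(1,2,2)] assms(2)] by simp

lemma tangent_vector_zero_function:
  assumes "v \<in> tangent_space A p"
  shows "v (\<lambda>q. 0) = 0"
proof (cases "(\<lambda>q. 0) \<in> scalar_fields A")
  case True
  have "\<forall>c. \<forall>f\<in>scalar_fields A. v (\<lambda>q. c * f q) = c * v f"
    using assms by (simp add: tangent_space_def)
  from bspec[OF spec[OF this, of 0] True] show ?thesis by simp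
qed (use assms in \<open>simp add: tangent_space_def\<close>)

lemma tangent_vector_one_function:
  assumes "v \<in> tangent_space A p"
  shows "v (\<lambda>q. 1) = 0"
proof (cases "(\<lambda>q. 1) \<in> scalar_fields A")
  case True
  have "\<forall>f\<in>scalar_fields A. \<forall>h\<in>scalar_fields A. v (\<lambda>q. f q * h q) = v f * h p + f p * v h"
    using assms by (simp add: tangent_space_def)
  from bspec[OF bspec[OF this True] True] show ?thesis by simp
qed (use assms in \<open>simp add: tangent_space_def\<close>)

section \<open>Metric connections in the presence of a unit vector field\<close>

text \<open>
  The common setting of \<open>g\<close> with \<open>D\<close> and of the associated metric with its own Levi-Civita
  connection.  The tensor \<open>\<phi>\<close> is replaced by what the argument takes from it: smoothness of the
  horizontal projection \<open>- \<phi>\<^sup>2\<close>, and \<open>\<xi>\<close> being the unit field dual to \<open>\<eta>\<close>.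
\<close>

locale unit_field_levi_civita =
  fixes A :: "('m::{t2_space,second_countable_topology}, 'e::euclidean_space) atlas"
    and \<xi> :: "'m vfield"
    and \<eta> :: "'m \<Rightarrow> 'm tvec \<Rightarrow> real"
    and G :: "'m \<Rightarrow> 'm tvec \<Rightarrow> 'm tvec \<Rightarrow> real"
    and D :: "'m connection"
  assumes atlas: "smooth_atlas A"
    and xi: "\<xi> \<in> vector_fields A"
    and eta: "one_form A \<eta>"
    and eta_xi: "\<And>p. \<eta> p (\<xi> p) = 1"
    and horizontal_field: "\<And>X. X \<in> vector_fields A \<Longrightarrow> horizontal \<xi> \<eta> X \<in> vector_fields A"
    and G_sym: "\<And>p u v. u \<in> tangent_space A p \<Longrightarrow> v \<in> tangent_space A p \<Longrightarrow> G p u v = G p v u"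
    and G_add: "\<And>p u v w. u \<in> tangent_space A p \<Longrightarrow> v \<in> tangent_space A p \<Longrightarrow>
          w \<in> tangent_space A p \<Longrightarrow> G p (u + v) w = G p u w + G p v w"
    and G_scale: "\<And>p c u v. u \<in> tangent_space A p \<Longrightarrow> v \<in> tangent_space A p \<Longrightarrow>
          G p (c *\<^sub>T u) v = c * G p u v"
    and G_xi: "\<And>p v. v \<in> tangent_space A p \<Longrightarrow> G p v (\<xi> p) = \<eta> p v"
    and levi_civita: "levi_civita_connection A G D"
begin

abbreviation "hor \<equiv> horizontal \<xi> \<eta>"

lemma eta_add:
  "u \<in> tangent_space A p \<Longrightarrow> v \<in> tangent_space A p \<Longrightarrow> \<eta> p (u + v) = \<eta> p u + \<eta> p v"
  and eta_scale: "u \<in> tangent_space A p \<Longrightarrow> \<eta> p (c *\<^sub>T u) = c * \<eta> p u"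
  and eta_scalar_field: "X \<in> vector_fields A \<Longrightarrow> vf_form \<eta> X \<in> scalar_fields A"
  using eta by (auto simp: one_form_def)

lemma eta_minus: "u \<in> tangent_space A p \<Longrightarrow> \<eta> p (- u) = - \<eta> p u"
  using eta_scale[of u p "- 1"] by (simp add: tvec_scale_def fun_Compl_def)

lemma eta_diff:
  "u \<in> tangent_space A p \<Longrightarrow> v \<in> tangent_space A p \<Longrightarrow> \<eta> p (u - v) = \<eta> p u - \<eta> p v"
  using eta_add[of u p "- v"] by (simp add: tangent_space_minus eta_minus)

lemma G_minus:
  "u \<in> tangent_space A p \<Longrightarrow> v \<in> tangent_space A p \<Longrightarrow> G p (- u) v = - G p u v"
  using G_scale[of u p v "- 1"] by (simp add: tvec_scale_def fun_Compl_def)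

lemma G_diff:
  "u \<in> tangent_space A p \<Longrightarrow> v \<in> tangent_space A p \<Longrightarrow> w \<in> tangent_space A p \<Longrightarrow>
    G p (u - v) w = G p u w - G p v w"
  using G_add[of u p "- v" w] by (simp add: tangent_space_minus G_minus)

lemma D_field: "X \<in> vector_fields A \<Longrightarrow> Y \<in> vector_fields A \<Longrightarrow> D X Y \<in> vector_fields A"
  and D_add: "X \<in> vector_fields A \<Longrightarrow> Y \<in> vector_fields A \<Longrightarrow> Y' \<in> vector_fields A \<Longrightarrow>
    D X (Y + Y') = D X Y + D X Y'"
  and D_scale: "f \<in> scalar_fields A \<Longrightarrow> X \<in> vector_fields A \<Longrightarrow> Y \<in> vector_fields A \<Longrightarrow>
    D X (f *\<^sub>V Y) = vf_apply X f *\<^sub>V Y + f *\<^sub>V D X Y"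
  and D_metric: "X \<in> vector_fields A \<Longrightarrow> Y \<in> vector_fields A \<Longrightarrow> Z \<in> vector_fields A \<Longrightarrow>
    X p (\<lambda>q. G q (Y q) (Z q)) = G p (D X Y p) (Z p) + G p (Y p) (D X Z p)"
  and torsion_free: "X \<in> vector_fields A \<Longrightarrow> Y \<in> vector_fields A \<Longrightarrow>
    lie_bracket X Y = D X Y - D Y X"
  using levi_civita
  by (simp_all add: levi_civita_connection_def affine_connection_def vf_apply_def vf_bilin_def)

lemma D_diff:
  assumes "X \<in> vector_fields A" "Y \<in> vector_fields A" "Z \<in> vector_fields A"
  shows "D X (Y - Z) = D X Y - D X Z"
  using D_add[OF assms(1) vector_fields_diff[OF atlas assms(2,3)] assms(3)] by simp

lemma D_minus:
  assumes "X \<in> vector_fields A" "Y \<in> vector_fields A"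
  shows "D X (- Y) = - D X Y"
  using D_diff[OF assms(1) vector_fields_diff[OF atlas assms(2,2)] assms(2)]
    D_diff[OF assms(1,2,2)] by simp

text \<open>The torsion identity exhibits the bracket as a difference of two vector fields.\<close>

lemma lie_bracket_field:
  "X \<in> vector_fields A \<Longrightarrow> Y \<in> vector_fields A \<Longrightarrow> lie_bracket X Y \<in> vector_fields A"
  by (simp add: torsion_free D_field vector_fields_diff atlas)

lemma curvature_field:
  "X \<in> vector_fields A \<Longrightarrow> Y \<in> vector_fields A \<Longrightarrow> Z \<in> vector_fields A \<Longrightarrow>
    curvature D X Y Z \<in> vector_fields A"
  by (simp add: curvature_def D_field vector_fields_diff lie_bracket_field atlas)

lemma curvature_minus:
  assumes "X \<in> vector_fields A" "Y \<in> vector_fields A" "Z \<in> vector_fields A"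
  shows "curvature D X Y (- Z) = - curvature D X Y Z"
  using assms by (simp add: curvature_def D_minus D_field lie_bracket_field)

lemma hor_apply: "hor X p = X p - \<eta> p (X p) *\<^sub>T \<xi> p"
  by (simp add: horizontal_def vf_form_def vfield_scale_def)

lemmas tangent_intros = tangent_space_intros vector_field_at vector_field_at[OF xi]

lemma eta_hor: "X p \<in> tangent_space A p \<Longrightarrow> \<eta> p (hor X p) = 0"
  by (simp add: hor_apply eta_diff eta_scale eta_xi tangent_intros)

lemma hor_diff:
  assumes "\<And>p. X p \<in> tangent_space A p" "\<And>p. Y p \<in> tangent_space A p"
  shows "hor (X - Y) = hor X - hor Y"
  by (rule ext)+ (simp add: hor_apply eta_diff assms tvec_scale_def algebra_simps)

text \<open>\<open>hor\<close> is the \<open>G\<close>-orthogonal projection along \<open>\<xi>\<close>, hence self-adjoint.\<close>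

lemma G_hor_swap:
  assumes "X \<in> vector_fields A" "Y \<in> vector_fields A"
  shows "G p (hor X p) (Y p) = G p (X p) (hor Y p)"
proof -
  note t = assms[THEN vector_field_at, of p] vector_field_at[OF xi, of p]
  have "G p (hor X p) (Y p) = G p (X p) (Y p) - \<eta> p (X p) * \<eta> p (Y p)"
    using t G_xi[of "Y p" p] G_sym[of "\<xi> p" p "Y p"]
    by (simp add: hor_apply G_diff G_scale tangent_intros)
  moreover have "G p (X p) (hor Y p) = G p (X p) (Y p) - \<eta> p (X p) * \<eta> p (Y p)"
    using t G_xi[of "X p" p] G_sym[of "\<xi> p" p "X p"] G_sym[of "Y p" p "X p"]
      G_sym[of "X p" p "hor Y p"]
    by (simp add: hor_apply G_diff G_scale tangent_intros)
  ultimately show ?thesis by simp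
qed

text \<open>Half the derivative of the constant function \<open>G \<xi> \<xi> = 1\<close>.\<close>

lemma eta_D_xi:
  assumes "X \<in> vector_fields A"
  shows "\<eta> p (D X \<xi> p) = 0"
proof -
  have t: "D X \<xi> p \<in> tangent_space A p"
    using assms xi by (simp add: D_field vector_field_at)
  have "(\<lambda>q. G q (\<xi> q) (\<xi> q)) = (\<lambda>q. 1)"
    by (simp add: G_xi eta_xi vector_field_at xi)
  then have "0 = G p (D X \<xi> p) (\<xi> p) + G p (\<xi> p) (D X \<xi> p)"
    using D_metric[OF assms xi xi, of p] tangent_vector_one_function[OF vector_field_at[OF assms]]
    by simp
  then show ?thesis
    using t G_sym[OF t vector_field_at[OF xi]] by (simp add: G_xi)
qed

text \<open>The Weingarten formula, from the derivative of \<open>G (hor Z) \<xi> = 0\<close>.  On the right the projection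
  of \<open>Z\<close> disappears because \<open>D X \<xi>\<close> is horizontal.\<close>

lemma eta_D_horizontal:
  assumes "X \<in> vector_fields A" "Z \<in> vector_fields A"
  shows "\<eta> p (D X (hor Z) p) = - G p (D X \<xi> p) (Z p)"
proof -
  have Z: "hor Z \<in> vector_fields A" by (rule horizontal_field[OF assms(2)])
  have t: "D X \<xi> p \<in> tangent_space A p" "D X (hor Z) p \<in> tangent_space A p"
    using assms xi Z by (simp_all add: D_field vector_field_at)
  have "(\<lambda>q. G q (hor Z q) (\<xi> q)) = (\<lambda>q. 0)"
    by (simp add: G_xi eta_hor vector_field_at assms Z)
  then have "0 = \<eta> p (D X (hor Z) p) + G p (hor Z p) (D X \<xi> p)"
    using D_metric[OF assms(1) Z xi, of p] G_xi[OF t(2)]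
      tangent_vector_zero_function[OF vector_field_at[OF assms(1)]] by simp
  moreover have "hor (D X \<xi>) = D X \<xi>"
    by (rule ext)+ (simp add: hor_apply eta_D_xi assms tvec_scale_def)
  then have "G p (hor Z p) (D X \<xi> p) = G p (D X \<xi> p) (Z p)"
    using G_hor_swap[OF assms(2) D_field[OF assms(1) xi], of p]
      G_sym[OF t(1) vector_field_at[OF assms(2)]] by simp
  ultimately show ?thesis by simp
qed

text \<open>
  The vertical part \<open>\<eta> V \<xi>\<close> of \<open>V\<close> is not parallel: its derivative has the horizontal part
  \<open>\<eta> V D X \<xi>\<close>.  This is the source of the shape operator in the curvature identity.
\<close>

lemma hor_D_hor:
  assumes X: "X \<in> vector_fields A" and V: "V \<in> vector_fields A"
  shows "hor (D X (hor V)) = hor (D X V) - vf_form \<eta> V *\<^sub>V D X \<xi>"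
proof -
  have vertical_field: "vf_form \<eta> V *\<^sub>V \<xi> \<in> vector_fields A"
    using vector_fields_diff[OF atlas V horizontal_field[OF V]] by (simp add: horizontal_def)
  have *: "D X (hor V) = D X V - (vf_apply X (vf_form \<eta> V) *\<^sub>V \<xi> + vf_form \<eta> V *\<^sub>V D X \<xi>)"
    unfolding horizontal_def
    by (simp only: D_diff[OF X V vertical_field] D_scale[OF eta_scalar_field[OF V] X xi])
  have t: "D X V p \<in> tangent_space A p" "D X \<xi> p \<in> tangent_space A p" "\<xi> p \<in> tangent_space A p"
    for p using X V xi by (simp_all add: D_field vector_field_at)
  show ?thesis
    by (rule ext)+ (simp add: * hor_apply vfield_scale_def eta_diff eta_add eta_scale eta_xi
      eta_D_xi[OF X] t tangent_space_intros, simp add: tvec_scale_def vf_form_def algebra_simps)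
qed

section \<open>The Schouten-van Kampen connection and its curvature\<close>

text \<open>
  Only the derivative of the coefficient survives in the vertical part of \<open>D X (\<eta> Y \<xi>)\<close>, since
  \<open>D X \<xi>\<close> is horizontal.
\<close>

lemma svk_eq:
  assumes "X \<in> vector_fields A" "vf_form \<eta> Y \<in> scalar_fields A"
  shows "schouten_van_kampen \<xi> \<eta> D X Y =
    hor (D X (hor Y)) + vf_apply X (vf_form \<eta> Y) *\<^sub>V \<xi>"
proof -
  have t: "D X \<xi> p \<in> tangent_space A p" "\<xi> p \<in> tangent_space A p" for p
    using assms(1) xi by (simp_all add: D_field vector_field_at)
  have "D X (vertical \<xi> \<eta> Y) = vf_apply X (vf_form \<eta> Y) *\<^sub>V \<xi> + vf_form \<eta> Y *\<^sub>V D X \<xi>"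
    unfolding vertical_def by (rule D_scale[OF assms(2,1) xi])
  then have "vf_form \<eta> (D X (vertical \<xi> \<eta> Y)) = vf_apply X (vf_form \<eta> Y)"
    by (intro ext) (simp add: vf_form_def[of \<eta> "_ + _"] vfield_scale_def eta_add eta_scale eta_xi
      eta_D_xi assms(1) t tangent_space_intros)
  then show ?thesis
    by (simp add: schouten_van_kampen_def vertical_def)
qed

lemma
  assumes X: "X \<in> vector_fields A" and Y: "Y \<in> vector_fields A"
  shows hor_svk: "hor (schouten_van_kampen \<xi> \<eta> D X Y) = hor (D X (hor Y))"
    and eta_svk: "vf_form \<eta> (schouten_van_kampen \<xi> \<eta> D X Y) = vf_apply X (vf_form \<eta> Y)"
proof -
  have t: "D X (hor Y) p \<in> tangent_space A p" "hor (D X (hor Y)) p \<in> tangent_space A p"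
    "\<xi> p \<in> tangent_space A p" for p
    using X Y xi by (simp_all add: D_field vector_field_at horizontal_field)
  show *: "vf_form \<eta> (schouten_van_kampen \<xi> \<eta> D X Y) = vf_apply X (vf_form \<eta> Y)"
    by (rule ext) (simp add: svk_eq X Y eta_scalar_field vf_form_def[of \<eta> "_ + _"]
      vfield_scale_def eta_add eta_scale eta_xi eta_hor t tangent_space_intros)
  show "hor (schouten_van_kampen \<xi> \<eta> D X Y) = hor (D X (hor Y))"
    unfolding horizontal_def[of _ _ "schouten_van_kampen \<xi> \<eta> D X Y"] *
    by (simp add: svk_eq X Y eta_scalar_field)
qed

lemma svk_svk:
  assumes X: "X \<in> vector_fields A" and Y: "Y \<in> vector_fields A" and Z: "Z \<in> vector_fields A"
  shows "schouten_van_kampen \<xi> \<eta> D X (schouten_van_kampen \<xi> \<eta> D Y Z) =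
    hor (D X (D Y (hor Z))) - vf_form \<eta> (D Y (hor Z)) *\<^sub>V D X \<xi>
    + vf_apply X (vf_apply Y (vf_form \<eta> Z)) *\<^sub>V \<xi>"
proof -
  have "vf_form \<eta> (schouten_van_kampen \<xi> \<eta> D Y Z) \<in> scalar_fields A"
    using Y eta_scalar_field[OF Z] by (simp add: eta_svk[OF Y Z] vector_fields_def)
  note svk_eq[OF X this, unfolded eta_svk[OF Y Z] hor_svk[OF Y Z]]
  also note hor_D_hor[OF X D_field[OF Y horizontal_field[OF Z]]]
  finally show ?thesis .
qed

text \<open>
  The vertical terms cancel by the definition of the bracket as a commutator of derivations.
\<close>

lemma curvature_svk:
  assumes X: "X \<in> vector_fields A" and Y: "Y \<in> vector_fields A" and Z: "Z \<in> vector_fields A"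
  shows "curvature (schouten_van_kampen \<xi> \<eta> D) X Y Z =
    hor (curvature D X Y (hor Z))
    - vf_form \<eta> (D Y (hor Z)) *\<^sub>V D X \<xi> + vf_form \<eta> (D X (hor Z)) *\<^sub>V D Y \<xi>"
proof -
  let ?f = "vf_form \<eta> Z" and ?B = "lie_bracket X Y"
  have B: "?B \<in> vector_fields A" by (rule lie_bracket_field[OF X Y])
  have "hor (curvature D X Y (hor Z)) =
      hor (D X (D Y (hor Z))) - hor (D Y (D X (hor Z))) - hor (D ?B (hor Z))"
    by (simp add: curvature_def hor_diff vector_field_at D_field horizontal_field X Y Z B
      tangent_space_diff)
  moreover have "vf_apply ?B ?f *\<^sub>V \<xi> =
      vf_apply X (vf_apply Y ?f) *\<^sub>V \<xi> - vf_apply Y (vf_apply X ?f) *\<^sub>V \<xi>"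
    by (rule ext)+ (simp add: vfield_scale_def tvec_scale_def lie_bracket_def vf_apply_def
      algebra_simps)
  ultimately show ?thesis
    by (simp add: curvature_def svk_svk[OF X Y Z] svk_svk[OF Y X Z]
      svk_eq[OF B eta_scalar_field[OF Z]])
qed

text \<open>The Gauss equation of the horizontal distribution.\<close>

lemma curvature4_svk:
  assumes X: "X \<in> vector_fields A" and Y: "Y \<in> vector_fields A"
    and Z: "Z \<in> vector_fields A" and W: "W \<in> vector_fields A"
  shows "curvature4 G (schouten_van_kampen \<xi> \<eta> D) X Y Z W p =
    curvature4 G D X Y (hor Z) (hor W) p
    + pi1 G (shape_operator \<xi> D X) (shape_operator \<xi> D Y) Z W p"
proof -
  let ?R = "curvature D X Y (hor Z)"
  have R: "?R \<in> vector_fields A" by (simp add: curvature_field X Y Z horizontal_field)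
  have t: "D X \<xi> p \<in> tangent_space A p" "D Y \<xi> p \<in> tangent_space A p"
    "Z p \<in> tangent_space A p" "W p \<in> tangent_space A p" "hor ?R p \<in> tangent_space A p"
    using X Y Z W xi R by (simp_all add: D_field vector_field_at horizontal_field)
  have "curvature4 G (schouten_van_kampen \<xi> \<eta> D) X Y Z W p =
      G p (hor ?R p) (W p) - \<eta> p (D Y (hor Z) p) * G p (D X \<xi> p) (W p)
      + \<eta> p (D X (hor Z) p) * G p (D Y \<xi> p) (W p)"
    by (simp add: curvature4_def curvature_svk X Y Z vf_bilin_def vfield_scale_def G_add G_diff
      G_scale vf_form_def t tangent_space_intros)
  also have "G p (hor ?R p) (W p) = G p (?R p) (hor W p)"
    by (rule G_hor_swap[OF R W])
  finally show ?thesis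
    by (simp add: eta_D_horizontal X Y Z curvature4_def pi1_def shape_operator_def vf_bilin_def
      G_minus t)
qed

lemma curvature4_minus_minus:
  assumes X: "X \<in> vector_fields A" and Y: "Y \<in> vector_fields A"
    and Z: "Z \<in> vector_fields A" and W: "W \<in> vector_fields A"
  shows "curvature4 G D X Y (- Z) (- W) p = curvature4 G D X Y Z W p"
proof -
  have t: "curvature D X Y Z p \<in> tangent_space A p" "W p \<in> tangent_space A p"
    using assms by (simp_all add: curvature_field vector_field_at)
  show ?thesis
    using G_sym[OF t] G_sym[OF t(1) tangent_space_minus[OF t(2)]]
    by (simp add: curvature4_def vf_bilin_def curvature_minus X Y Z G_minus t tangent_space_minus)
qed

end

section \<open>Almost contact B-metric manifolds\<close>

context almost_contact_B_metric_manifold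
begin

lemma phi_phi_field: "X \<in> vector_fields A \<Longrightarrow> vf_endo \<phi> (vf_endo \<phi> X) = - horizontal \<xi> \<eta> X"
  by (rule ext)+ (simp add: vf_endo_def horizontal_def phi_phi vector_field_at vfield_scale_def
    vf_form_def)

text \<open>The horizontal projection \<open>- \<phi>\<^sup>2\<close> inherits smoothness from \<open>\<phi>\<close>.\<close>

lemma horizontal_vector_field:
  assumes "X \<in> vector_fields A"
  shows "horizontal \<xi> \<eta> X \<in> vector_fields A"
proof -
  have "vf_endo \<phi> (vf_endo \<phi> X) \<in> vector_fields A"
    using phi assms by (simp add: endomorphism_field_def)
  then show ?thesis
    using vector_fields_minus[OF atlas] phi_phi_field[OF assms] by fastforce
qed

lemma phi_tangent: "v \<in> tangent_space A p \<Longrightarrow> \<phi> p v \<in> tangent_space A p"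
  using phi by (simp add: endomorphism_field_def)

lemma xi_tangent: "\<xi> p \<in> tangent_space A p"
  by (rule vector_field_at[OF xi])

lemma g_sym: "u \<in> tangent_space A p \<Longrightarrow> v \<in> tangent_space A p \<Longrightarrow> g p u v = g p v u"
  and g_add: "u \<in> tangent_space A p \<Longrightarrow> v \<in> tangent_space A p \<Longrightarrow> w \<in> tangent_space A p \<Longrightarrow>
    g p (u + v) w = g p u w + g p v w"
  and g_scale: "u \<in> tangent_space A p \<Longrightarrow> v \<in> tangent_space A p \<Longrightarrow> g p (c *\<^sub>T u) v = c * g p u v"
  using metric unfolding pseudo_riemannian_metric_def by blast+

lemma g_minus:
  "u \<in> tangent_space A p \<Longrightarrow> v \<in> tangent_space A p \<Longrightarrow> g p (- u) v = - g p u v"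
  using g_scale[of u p v "- 1"] by (simp add: tvec_scale_def fun_Compl_def)

lemma g_zero: "v \<in> tangent_space A p \<Longrightarrow> g p v 0 = 0"
  using g_add[of 0 p 0 v] g_sym[of v p 0] by (simp add: tangent_space_zero)

text \<open>The B-metric identity at \<open>w = \<xi>\<close>, where \<open>\<phi> \<xi> = 0\<close>.\<close>

lemma g_xi: "v \<in> tangent_space A p \<Longrightarrow> g p v (\<xi> p) = \<eta> p v"
  using B_metric[of v p "\<xi> p"]
  by (simp add: phi_xi eta_xi g_zero phi_tangent xi_tangent)

text \<open>
  Unlike the fundamental 2-form of an almost contact metric manifold, \<open>g v (\<phi> w)\<close> is symmetric: the
  B-metric identity for \<open>v\<close> and \<open>\<phi> w\<close> reduces \<open>g (\<phi> v) (\<phi> (\<phi> w))\<close>, which is \<open>- g (\<phi> v) w\<close>.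
\<close>

lemma g_phi_sym:
  assumes v: "v \<in> tangent_space A p" and w: "w \<in> tangent_space A p"
  shows "g p v (\<phi> p w) = g p w (\<phi> p v)"
proof -
  note t = v w phi_tangent[OF v] phi_tangent[OF w] xi_tangent[of p]
  have "- g p v (\<phi> p w) = g p (\<phi> p v) (\<phi> p (\<phi> p w))"
    using B_metric[OF t(1,4)] t by (simp add: eta_phi)
  also have "\<dots> = g p (\<phi> p (\<phi> p w)) (\<phi> p v)"
    by (rule g_sym[OF t(3) phi_tangent[OF t(4)]])
  also have "\<dots> = g p (- w + \<eta> p w *\<^sub>T \<xi> p) (\<phi> p v)"
    by (simp only: phi_phi[OF w])
  also have "\<dots> = - g p w (\<phi> p v) + \<eta> p w * g p (\<xi> p) (\<phi> p v)"
    by (simp only: g_add g_minus g_scale tangent_space_intros t)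
  also have "g p (\<xi> p) (\<phi> p v) = 0"
    using g_sym[OF t(5,3)] g_xi[OF t(3)] eta_phi[OF v] by simp
  finally show ?thesis by simp
qed

lemma unit_field_metric:
  assumes "levi_civita_connection A g D"
  shows "unit_field_levi_civita A \<xi> \<eta> g D"
  by unfold_locales
    (simp_all add: atlas xi eta eta_xi horizontal_vector_field g_add g_scale g_xi assms, rule g_sym)

lemma unit_field_associated_metric:
  assumes "levi_civita_connection A (associated_metric \<phi> \<eta> g) D"
  shows "unit_field_levi_civita A \<xi> \<eta> (associated_metric \<phi> \<eta> g) D"
proof unfold_locales
  have eta_add: "\<eta> p (u + v) = \<eta> p u + \<eta> p v"
    if "u \<in> tangent_space A p" "v \<in> tangent_space A p" for p u v
    using eta that by (simp add: one_form_def)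
  have eta_scale: "\<eta> p (c *\<^sub>T u) = c * \<eta> p u" if "u \<in> tangent_space A p" for p c u
    using eta that by (simp add: one_form_def)
  fix p u v
  assume u: "u \<in> tangent_space A p" and v: "v \<in> tangent_space A p"
  show "associated_metric \<phi> \<eta> g p u v = associated_metric \<phi> \<eta> g p v u"
    using g_phi_sym[OF u v] by (simp add: associated_metric_def)
  show "associated_metric \<phi> \<eta> g p (c *\<^sub>T u) v = c * associated_metric \<phi> \<eta> g p u v" for c
    using u v
    by (simp add: associated_metric_def g_scale eta_scale phi_tangent algebra_simps)
  show "associated_metric \<phi> \<eta> g p (u + v) w =
      associated_metric \<phi> \<eta> g p u w + associated_metric \<phi> \<eta> g p v w"
    if "w \<in> tangent_space A p" for w
    using u v that
    by (simp add: associated_metric_def g_add eta_add phi_tangent algebra_simps)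
  show "associated_metric \<phi> \<eta> g p u (\<xi> p) = \<eta> p u"
    using u by (simp add: associated_metric_def phi_xi g_zero eta_xi)
qed (simp_all add: atlas xi eta eta_xi horizontal_vector_field assms)

lemma curvature4_svk_phi:
  assumes "unit_field_levi_civita A \<xi> \<eta> G D"
    and "X \<in> vector_fields A" "Y \<in> vector_fields A" "Z \<in> vector_fields A" "W \<in> vector_fields A"
  shows "curvature4 G (schouten_van_kampen \<xi> \<eta> D) X Y Z W p =
    curvature4 G D X Y (vf_endo \<phi> (vf_endo \<phi> Z)) (vf_endo \<phi> (vf_endo \<phi> W)) p
    + pi1 G (shape_operator \<xi> D X) (shape_operator \<xi> D Y) Z W p"
proof -
  interpret unit_field_levi_civita A \<xi> \<eta> G D by (rule assms(1))
  show ?thesis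
    using assms(2-)
    by (simp add: curvature4_svk phi_phi_field curvature4_minus_minus horizontal_field)
qed

end

theorem theorem7p15:
  fixes A :: "('m::{t2_space,second_countable_topology}, 'e::euclidean_space) atlas"
    and n :: nat
    and \<phi> :: "'m \<Rightarrow> 'm tvec \<Rightarrow> 'm tvec"
    and \<xi> :: "'m vfield"
    and \<eta> :: "'m \<Rightarrow> 'm tvec \<Rightarrow> real"
    and g g' :: "'m \<Rightarrow> 'm tvec \<Rightarrow> 'm tvec \<Rightarrow> real"
    and D D' :: "'m connection"
    and x y z w :: "'m vfield"
    and p :: 'm
  assumes "almost_contact_B_metric_manifold A n \<phi> \<xi> \<eta> g"
    and "g' = associated_metric \<phi> \<eta> g"
    and "levi_civita_connection A g D"
    and "levi_civita_connection A g' D'"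
    and "x \<in> vector_fields A" "y \<in> vector_fields A" "z \<in> vector_fields A" "w \<in> vector_fields A"
  shows "curvature4 g (schouten_van_kampen \<xi> \<eta> D) x y z w p =
           curvature4 g D x y (vf_endo \<phi> (vf_endo \<phi> z)) (vf_endo \<phi> (vf_endo \<phi> w)) p
           + pi1 g (shape_operator \<xi> D x) (shape_operator \<xi> D y) z w p
       \<and> curvature4 g' (schouten_van_kampen \<xi> \<eta> D') x y z w p =
           curvature4 g' D' x y (vf_endo \<phi> (vf_endo \<phi> z)) (vf_endo \<phi> (vf_endo \<phi> w)) p
           + pi1 g' (shape_operator \<xi> D' x) (shape_operator \<xi> D' y) z w p"
proof -
  interpret almost_contact_B_metric_manifold A n \<phi> \<xi> \<eta> g by (rule assms(1))
  have "unit_field_levi_civita A \<xi> \<eta> g D" "unit_field_levi_civita A \<xi> \<eta> g' D'"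
    using unit_field_metric unit_field_associated_metric assms(2-4) by blast+
  then show ?thesis
    using assms(5-8) by (simp add: curvature4_svk_phi)
qed

end
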